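(* Let $a,b,c$ be positive integers with $a\leqslant b\leqslant c$. Suppose that every nonnegative integer $n$ can be written as $n=x(ax+1)+y(by+1)+z(cz+1)$ with $x,y,z\in\mathbb{Z}$. Then $(a,b,c)$ is one of the following $17$ triples: $$(1,1,2),(1,2,2),(1,2,3),(1,2,4),(1,2,5),(2,2,2),(2,2,3),(2,2,4),(2,2,5),(2,2,6),$$ $$(2,3,3),(2,3,4),(2,3,5),(2,3,7),(2,3,8),(2,3,9),(2,3,10).$$ *)

theory Defs
  imports Main
begin

end

theory Submission
  imports Defs
begin

text \<open>
  Every value of \<open>x (k x + 1)\<close> with \<open>x \<noteq> 0\<close> is at least \<open>k - 1\<close>, so a small target \<open>n\<close> can only be
  reached when the coefficients are small. The targets 1 and 2 force \<open>(a, b)\<close> into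
  \<open>(1,1), (1,2), (2,2), (2,3)\<close>; the least number missed by the two-term sum (1, 4, 5 and 9
  respectively) then bounds \<open>c\<close>, and the one remaining candidate \<open>(2,3,6)\<close> misses 48.
\<close>

text \<open>Since \<open>x\<close> is at least \<open>-\<bar>x\<bar>\<close>, the value is at least
  \<open>\<bar>x\<bar> * (k * \<bar>x\<bar> - 1)\<close>, whose two factors are nonnegative and grow
  with \<open>\<bar>x\<bar>\<close>. The bound is sharp, attained at \<open>x = -m\<close>.\<close>

lemma quadratic_value_ge:
  fixes k m x :: int
  assumes "1 \<le> k" "1 \<le> m" "m \<le> \<bar>x\<bar>"
  shows "m * (k * m - 1) \<le> x * (k * x + 1)"
proof -
  have "k * m \<le> k * \<bar>x\<bar>"
    using assms by (intro mult_left_mono) auto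
  moreover have "1 \<le> k * m"
    using assms mult_mono[of 1 k 1 m] by simp
  ultimately have "m * (k * m - 1) \<le> \<bar>x\<bar> * (k * \<bar>x\<bar> - 1)"
    using assms by (intro mult_mono) linarith+
  also have "\<dots> = k * (x * x) - \<bar>x\<bar>"
    by (simp add: algebra_simps)
  also have "\<dots> \<le> x * (k * x + 1)"
    by (simp add: algebra_simps)
  finally show ?thesis .
qed

lemma quadratic_value_nonneg:
  fixes k x :: int
  assumes "1 \<le> k"
  shows "0 \<le> x * (k * x + 1)"
  using quadratic_value_ge[of k 1 x] assms by (cases "x = 0") fastforce+

lemma quadratic_value_zero_or_ge:
  fixes k x :: int
  assumes "1 \<le> k"
  shows "x * (k * x + 1) = 0 \<or> k - 1 \<le> x * (k * x + 1)"
  using quadratic_value_ge[of k 1 x] assms by (cases "x = 0") fastforce+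

lemma abs_less_of_quadratic_value_less:
  fixes k m x :: int
  assumes "1 \<le> k" "1 \<le> m" "x * (k * x + 1) < m * (k * m - 1)"
  shows "\<bar>x\<bar> < m"
  using quadratic_value_ge[of k m x] assms by linarith

text \<open>The cap 5 is one below \<open>3 * (1 * 3 - 1)\<close>, so only
  \<open>\<bar>x\<bar> < 3\<close> has to be checked. The caps 65, 69 and 50 for coefficients 2, 3
  and 6 come likewise from \<open>m\<close> = 6, 5 and 3.\<close>

lemma quadratic_values_one:
  fixes x :: int
  assumes "x * (x + 1) \<le> 5"
  shows "x * (x + 1) \<in> {0, 2}"
proof -
  have "\<bar>x\<bar> < 3"
    using abs_less_of_quadratic_value_less[of 1 3 x] assms by simp
  then have "x = -2 \<or> x = -1 \<or> x = 0 \<or> x = 1 \<or> x = 2"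
    by presburger
  then show ?thesis
    using assms by (elim disjE) simp_all
qed

lemma quadratic_values_two:
  fixes x :: int
  assumes "x * (2 * x + 1) \<le> 65"
  shows "x * (2 * x + 1) \<in> {0, 1, 3, 6, 10, 15, 21, 28, 36, 45, 55}"
proof -
  have "\<bar>x\<bar> < 6"
    using abs_less_of_quadratic_value_less[of 2 6 x] assms by simp
  then have "x = -5 \<or> x = -4 \<or> x = -3 \<or> x = -2 \<or> x = -1 \<or> x = 0 \<or> x = 1 \<or> x = 2 \<or> x = 3 \<or> x = 4 \<or> x = 5"
    by presburger
  then show ?thesis
    using assms by (elim disjE) simp_all
qed

lemma quadratic_values_three:
  fixes x :: int
  assumes "x * (3 * x + 1) \<le> 69"
  shows "x * (3 * x + 1) \<in> {0, 2, 4, 10, 14, 24, 30, 44, 52}"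
proof -
  have "\<bar>x\<bar> < 5"
    using abs_less_of_quadratic_value_less[of 3 5 x] assms by simp
  then have "x = -4 \<or> x = -3 \<or> x = -2 \<or> x = -1 \<or> x = 0 \<or> x = 1 \<or> x = 2 \<or> x = 3 \<or> x = 4"
    by presburger
  then show ?thesis
    using assms by (elim disjE) simp_all
qed

lemma quadratic_values_six:
  fixes x :: int
  assumes "x * (6 * x + 1) \<le> 50"
  shows "x * (6 * x + 1) \<in> {0, 5, 7, 22, 26}"
proof -
  have "\<bar>x\<bar> < 3"
    using abs_less_of_quadratic_value_less[of 6 3 x] assms by simp
  then have "x = -2 \<or> x = -1 \<or> x = 0 \<or> x = 1 \<or> x = 2"
    by presburger
  then show ?thesis
    using assms by (elim disjE) simp_all
qed


theorem theorem1p1: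
  fixes a b c :: int
  assumes "0 < a" and "0 < b" and "0 < c"
    and "a \<le> b" and "b \<le> c"
    and "\<forall>n\<ge>0. \<exists>x y z :: int. n = x * (a * x + 1) + y * (b * y + 1) + z * (c * z + 1)"
  shows "(a, b, c) \<in>
    {(1,1,2), (1,2,2), (1,2,3), (1,2,4), (1,2,5), (2,2,2), (2,2,3), (2,2,4), (2,2,5), (2,2,6),
     (2,3,3), (2,3,4), (2,3,5), (2,3,7), (2,3,8), (2,3,9), (2,3,10)}"
proof -
  let ?A = "\<lambda>x. x * (a * x + 1)" and ?B = "\<lambda>x. x * (b * x + 1)" and ?C = "\<lambda>x. x * (c * x + 1)"
  have nonneg: "0 \<le> ?A x" "0 \<le> ?B x" "0 \<le> ?C x" for x
    using assms(1-3) by (auto intro!: quadratic_value_nonneg)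
  \<comment> \<open>Deleting \<open>mult_eq_0_iff\<close> keeps the equations \<open>= 0\<close>
    from being split into factors, so the introduction rule still matches.\<close>
  have gap: "?A x = 0 \<or> a - 1 \<le> ?A x" "?B x = 0 \<or> b - 1 \<le> ?B x" "?C x = 0 \<or> c - 1 \<le> ?C x" for x
    using assms(1-3) by (auto intro!: quadratic_value_zero_or_ge simp del: mult_eq_0_iff)
  have rep: "\<exists>x y z. n = ?A x + ?B y + ?C z \<and> ?A x \<le> n \<and> ?B y \<le> n \<and> ?C z \<le> n" if n: "0 \<le> n" for n
  proof -
    obtain x y z where "n = ?A x + ?B y + ?C z"
      using assms(6) n by blast
    then show ?thesis
      using nonneg(1)[of x] nonneg(2)[of y] nonneg(3)[of z] by (intro exI[of _ x] exI[of _ y] exI[of _ z]) linarith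
  qed
  \<comment> \<open>A product equal to 1 forces \<open>x\<close> to be 1 or -1, with values
    \<open>k + 1\<close> and \<open>k - 1\<close>; only \<open>k = 2\<close> can then give
    1.\<close>
  have not_one: "x * (k * x + 1) \<noteq> 1" if "1 \<le> k" "k \<noteq> 2" for k x :: int
  proof
    assume eq: "x * (k * x + 1) = 1"
    then have "x = 1 \<or> x = -1"
      by (metis zmult_eq_1_iff)
    then show False
      using eq that by auto
  qed
  \<comment> \<open>Three nonnegative integers with sum 1 include a 1.\<close>
  have two: "a = 2 \<or> b = 2 \<or> c = 2"
  proof (rule ccontr)
    assume neg: "\<not> ?thesis"
    obtain x y z where "1 = ?A x + ?B y + ?C z"
      using rep[of 1] by auto
    then show False
      using nonneg(1)[of x] nonneg(2)[of y] nonneg(3)[of z]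
        not_one[of a x] not_one[of b y] not_one[of c z] neg assms(1-3) by linarith
  qed
  consider "a = 1" "b = 1" "c = 2" | "a = 1" "b = 2" | "a = 2"
    using two assms(1-5) by linarith
  then show ?thesis
  proof cases
    case 1
    then show ?thesis by simp
  next
    case 2
    \<comment> \<open>For \<open>c\<close> at least 6 a nonzero third term is at least 5, so it
      vanishes in a sum of 4; but {0, 2} + {0, 1, 3} misses 4.\<close>
    have "c \<le> 5"
    proof (rule ccontr)
      assume "\<not> c \<le> 5"
      obtain x y z where xyz: "4 = ?A x + ?B y + ?C z" "?A x \<le> 4" "?B y \<le> 4" "?C z \<le> 4"
        using rep[of 4] by auto
      have "?A x \<in> {0, 2}" "?B y \<in> {0, 1, 3}"
        using quadratic_values_one[of x] quadratic_values_two[of y] xyz(2,3) 2 by auto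
      then show False
        using xyz gap(3)[of z] \<open>\<not> c \<le> 5\<close> by auto
    qed
    then have "c = 2 \<or> c = 3 \<or> c = 4 \<or> c = 5"
      using 2 assms by linarith
    then show ?thesis
      using 2 by auto
  next
    case 3
    \<comment> \<open>Otherwise \<open>b\<close> and \<open>c\<close> are both at least 4 and their
      nonzero terms exceed 2, leaving only the first term, which is 0 or 1.\<close>
    have "b \<le> 3"
    proof (rule ccontr)
      assume "\<not> b \<le> 3"
      obtain x y z where xyz: "2 = ?A x + ?B y + ?C z" "?A x \<le> 2" "?B y \<le> 2" "?C z \<le> 2"
        using rep[of 2] by auto
      have "?A x \<in> {0, 1}"
        using quadratic_values_two[of x] xyz(2) 3 by auto
      then show False
        using xyz gap(2)[of y] gap(3)[of z] \<open>\<not> b \<le> 3\<close> assms(5) by auto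
    qed
    then consider "b = 2" | "b = 3"
      using 3 assms by linarith
    then show ?thesis
    proof cases
      case b: 1
      \<comment> \<open>Two summands from {0, 1, 3} never give 5, and for \<open>c\<close> at least
        7 a nonzero third term is at least 6.\<close>
      have "c \<le> 6"
      proof (rule ccontr)
        assume "\<not> c \<le> 6"
        obtain x y z where xyz: "5 = ?A x + ?B y + ?C z" "?A x \<le> 5" "?B y \<le> 5" "?C z \<le> 5"
          using rep[of 5] by auto
        have "?A x \<in> {0, 1, 3}" "?B y \<in> {0, 1, 3}"
          using quadratic_values_two[of x] quadratic_values_two[of y] xyz(2,3) 3 b by auto
        then show False
          using xyz gap(3)[of z] \<open>\<not> c \<le> 6\<close> by auto
      qed
      then have "c = 2 \<or> c = 3 \<or> c = 4 \<or> c = 5 \<or> c = 6"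
        using b assms by linarith
      then show ?thesis
        using 3 b by auto
    next
      case b: 2
      \<comment> \<open>{0, 1, 3, 6} + {0, 2, 4} misses 9, and for \<open>c\<close> at least 11 a
        nonzero third term is at least 10.\<close>
      have "c \<le> 10"
      proof (rule ccontr)
        assume "\<not> c \<le> 10"
        obtain x y z where xyz: "9 = ?A x + ?B y + ?C z" "?A x \<le> 9" "?B y \<le> 9" "?C z \<le> 9"
          using rep[of 9] by auto
        have "?A x \<in> {0, 1, 3, 6}" "?B y \<in> {0, 2, 4}"
          using quadratic_values_two[of x] quadratic_values_three[of y] xyz(2,3) 3 b by auto
        then show False
          using xyz gap(3)[of z] \<open>\<not> c \<le> 10\<close> by auto
      qed
      \<comment> \<open>Here the third term may be nonzero, so all combinations of the values up to
        48 are checked.\<close>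
      moreover have "c \<noteq> 6"
      proof
        assume c: "c = 6"
        obtain x y z where xyz: "48 = ?A x + ?B y + ?C z" "?A x \<le> 48" "?B y \<le> 48" "?C z \<le> 48"
          using rep[of 48] by auto
        have "?A x \<in> {0, 1, 3, 6, 10, 15, 21, 28, 36, 45}" "?B y \<in> {0, 2, 4, 10, 14, 24, 30, 44}"
          "?C z \<in> {0, 5, 7, 22, 26}"
          using quadratic_values_two[of x] quadratic_values_three[of y] quadratic_values_six[of z]
            xyz(2-4) 3 b c by auto
        then show False
          using xyz(1) by fastforce
      qed
      ultimately have "c = 3 \<or> c = 4 \<or> c = 5 \<or> c = 7 \<or> c = 8 \<or> c = 9 \<or> c = 10"
        using b assms by linarith
      then show ?thesis
        using 3 b by auto
    qed
  qed
qed

end
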